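(* Let $\mu\preceq_{\mathrm{st}}\nu$ be Borel probability measures on $\mathbb{R}$ and let $F_*(x,y)=P_*((-\infty,x]\times(-\infty,y])$ be the cdf of $P_*=P_*(\mu,\nu)$. Then $H^{\wedge}\le F_*\le H^{\vee}$ on $\mathbb{R}^2$ for $$H^{\wedge}(x,y)=F_\nu(y)-\big[(F_\mu(y)-F_\mu(x))\wedge(F_\nu(y)-F_\nu(x))\big]_+,\qquad H^{\vee}(x,y)=F_\mu(x)\wedge F_\nu(y).$$ Moreover: (i) $F_*=H^{\wedge}$ if and only if $F=F_\mu-F_\nu$ is unimodal. (ii) $F_*=H^{\vee}$ if and only if $\mathcal{D}(\mu,\nu)$ is a singleton. If, in addition, $F$ is continuous, these conditions are further equivalent to $\mu=\nu$.
   Context: For finite Borel measures $\theta_1,\theta_2$ on $\mathbb{R}$ with cdf's $F_{\theta_i}(t)=\theta_i((-\infty,t])$, $\theta_1\preceq_{\mathrm{st}}\theta_2$ means $\theta_1(\mathbb{R})=\theta_2(\mathbb{R})$ and $F_{\theta_1}\ge F_{\theta_2}$; $\theta_1\le\theta_2$ means $\theta_1(A)\le\theta_2(A)$ for all Borel $A$. $\mathcal{D}(\mu,\nu)$ is the set of directional couplings: probability measures on $\mathbb{R}^2$ with first marginal $\mu$ and second marginal $\nu$ concentrated on $\mathbb{H}=\{(x,y):y\ge x\}$. $P_*(\mu,\nu)$ denotes the optimal directional coupling: the unique $P\in\mathcal{D}(\mu,\nu)$ such that $P((x,\infty)\times\cdot)=\nu_x$ for all $x\in\mathbb{R}$, where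 $\nu_x$ is the unique minimal element for $\preceq_{\mathrm{st}}$ of $\{\theta:\mu|_{(x,\infty)}\preceq_{\mathrm{st}}\theta\le\nu\}$ (equivalently, $F_{\nu_x}$ is the supremum of $F_\theta$ over this set). Existence and uniqueness hold whenever $\mu\preceq_{\mathrm{st}}\nu$. A right-continuous function on $\mathbb{R}$ is unimodal if it is nondecreasing on $(-\infty,x_0)$ and nonincreasing on $[x_0,\infty)$ for some $x_0\in\mathbb{R}$. $a\wedge b=\min(a,b)$ and $[a]_+=\max(a,0)$. *)

theory Defs
  imports "HOL-Probability.Probability"
begin

definition st_le :: "real measure \<Rightarrow> real measure \<Rightarrow> bool"  (infix "\<preceq>\<^sub>s\<^sub>t" 50) where
  "\<theta>1 \<preceq>\<^sub>s\<^sub>t \<theta>2 \<longleftrightarrow> measure \<theta>1 UNIV = measure \<theta>2 UNIV \<and> (\<forall>t. cdf \<theta>1 t \<ge> cdf \<theta>2 t)"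

definition directional_couplings ::
  "real measure \<Rightarrow> real measure \<Rightarrow> (real \<times> real) measure set" where
  "directional_couplings \<mu> \<nu> =
     {P. prob_space P \<and> sets P = sets borel \<and>
         distr P borel fst = \<mu> \<and> distr P borel snd = \<nu> \<and>
         (AE z in P. fst z \<le> snd z)}"

text \<open>
  The restriction of \<open>\<mu>\<close> to \<open>(x, \<infinity>)\<close> is kept a Borel measure on the whole line, by means of an
  indicator density. The relation \<open>\<theta> \<le> \<nu>\<close> is the library order on measures; it is setwise
  domination when both sides have the same measurable sets (\<open>le_measure\<close>), which is the case
  here if \<open>\<nu>\<close> is a Borel measure.
\<close>

definition admissible_targets :: "real measure \<Rightarrow> real measure \<Rightarrow> real \<Rightarrow> real measure set" where
  "admissible_targets \<mu> \<nu> x =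
     {\<theta>. finite_borel_measure \<theta> \<and> density \<mu> (indicator {x<..}) \<preceq>\<^sub>s\<^sub>t \<theta> \<and> \<theta> \<le> \<nu>}"

definition tail_target :: "real measure \<Rightarrow> real measure \<Rightarrow> real \<Rightarrow> real measure" where
  "tail_target \<mu> \<nu> x =
     (THE \<theta>. \<theta> \<in> admissible_targets \<mu> \<nu> x \<and>
             (\<forall>\<theta>' \<in> admissible_targets \<mu> \<nu> x. \<theta>' \<preceq>\<^sub>s\<^sub>t \<theta> \<longrightarrow> \<theta>' = \<theta>))"

definition optimal_coupling :: "real measure \<Rightarrow> real measure \<Rightarrow> (real \<times> real) measure" where
  "optimal_coupling \<mu> \<nu> =
     (THE P. P \<in> directional_couplings \<mu> \<nu> \<and>
             (\<forall>x. \<forall>B \<in> sets borel. measure P ({x<..} \<times> B) = measure (tail_target \<mu> \<nu> x) B))"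

definition optimal_cdf :: "real measure \<Rightarrow> real measure \<Rightarrow> real \<Rightarrow> real \<Rightarrow> real" where
  "optimal_cdf \<mu> \<nu> x y = measure (optimal_coupling \<mu> \<nu>) ({..x} \<times> {..y})"

definition H_wedge :: "real measure \<Rightarrow> real measure \<Rightarrow> real \<Rightarrow> real \<Rightarrow> real" where
  "H_wedge \<mu> \<nu> x y = cdf \<nu> y - max (min (cdf \<mu> y - cdf \<mu> x) (cdf \<nu> y - cdf \<nu> x)) 0"

definition H_vee :: "real measure \<Rightarrow> real measure \<Rightarrow> real \<Rightarrow> real \<Rightarrow> real" where
  "H_vee \<mu> \<nu> x y = min (cdf \<mu> x) (cdf \<nu> y)"

text \<open>Only meant for right-continuous functions, such as differences of cdf's.\<close>

definition unimodal :: "(real \<Rightarrow> real) \<Rightarrow> bool" where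
  "unimodal f \<longleftrightarrow> (\<exists>x0. mono_on {..<x0} f \<and> antimono_on {x0..} f)"

end

theory Submission
  imports Defs
begin

text \<open>
  Write \<open>F = F\<^sub>\<mu> - F\<^sub>\<nu>\<close>. Everything follows from an explicit formula for the cdf of the optimal coupling,
  \<open>H x y = (SUP z \<le> y. F\<^sub>\<nu> z - [F\<^sub>\<mu> z - F\<^sub>\<mu> x]\<^sub>+)\<close>.
  For \<open>x \<le> y\<close> it equals \<open>F\<^sub>\<mu> x\<close> minus the infimum of \<open>F\<close> over \<open>[x, y]\<close>, and for \<open>y < x\<close> it
  equals \<open>F\<^sub>\<nu> y\<close>.

  The formula is forced by an estimate. A target \<open>\<theta>\<close> that is admissible for \<open>\<mu>\<close> restricted to
  \<open>(x, \<infinity>)\<close> satisfies \<open>F\<^sub>\<theta> z \<le> [F\<^sub>\<mu> z - F\<^sub>\<mu> x]\<^sub>+\<close> by stochastic order, and gains at most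
  \<open>F\<^sub>\<nu> y - F\<^sub>\<nu> z\<close> between \<open>z\<close> and \<open>y\<close> because \<open>\<theta> \<le> \<nu>\<close>; optimizing over \<open>z\<close> gives
  \<open>F\<^sub>\<theta> y \<le> F\<^sub>\<nu> y - H x y\<close> (\<open>admissible_cdf_le\<close>). Conversely \<open>H\<close> is 2-increasing
  (\<open>H_2_increasing\<close>) with the right margins, so it is the cdf of a coupling \<open>P\<close>
  (\<open>joint_distribution_exists\<close>), and \<open>P\<close> is directional since \<open>H r r = F\<^sub>\<nu> r\<close>. The second marginal
  of \<open>P\<close> on \<open>(x, \<infinity>) \<times> \<real>\<close> is admissible, as for every directional coupling, and attains the estimate.
  It is therefore the least admissible target, and \<open>P\<close> is the optimal coupling.

  The remaining claims are about \<open>H\<close>. The lower bound \<open>H_wedge\<close> keeps only the terms \<open>z = y\<close> and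
  \<open>z = min x y\<close> of the supremum, so equality means that the infimum of \<open>F\<close> over each interval is its
  smaller end value: \<open>F\<close> is quasi-concave. For a nonnegative right-continuous function vanishing
  at both ends this is unimodality. The upper bound \<open>H_vee\<close> is the cdf of the comonotone coupling,
  which is directional, while \<open>H\<close> is the smallest cdf of a directional coupling; hence \<open>H = H_vee\<close>
  leaves room for only one. Finally, if \<open>F\<close> is continuous with \<open>F p > 0\<close>, let \<open>x \<le> p \<le> y\<close> be the
  nearest points with \<open>F = F p / 2\<close>. As \<open>F \<ge> F p / 2\<close> between them, \<open>H x y = H_vee x y\<close> forces
  \<open>F\<^sub>\<mu>\<close> and \<open>F\<^sub>\<nu>\<close> to be constant on \<open>[x, y]\<close>, which contradicts \<open>F p > F x\<close>.
\<close>

section \<open>Measures with ordered cdf increments\<close>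

text \<open>
  The difference of the two cdf's is itself a cdf, and its measure \<open>D\<close> added to \<open>M1\<close> has the cdf of
  \<open>M2\<close>. This turns a comparison of cdf increments, which concerns intervals only, into domination
  on all Borel sets.
\<close>

lemma finite_borel_measure_decompose:
  assumes M1: "finite_borel_measure M1" and M2: "finite_borel_measure M2"
    and mono: "mono (\<lambda>x. cdf M2 x - cdf M1 x)"
  obtains D where "finite_borel_measure D"
    and "\<And>A. A \<in> sets borel \<Longrightarrow> emeasure M2 A = emeasure M1 A + emeasure D A"
proof -
  interpret M1: finite_borel_measure M1 by fact
  interpret M2: finite_borel_measure M2 by fact
  define F where "F = (\<lambda>x. cdf M2 x - cdf M1 x)"
  define D where "D = interval_measure F"
  define m where "m = measure M2 (space M2) - measure M1 (space M1)"
  have F_mono: "F x \<le> F y" if "x \<le> y" for x y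
    using mono that by (simp add: F_def mono_def)
  have F_right: "continuous (at_right a) F" for a
    unfolding F_def by (intro continuous_intros M1.cdf_is_right_cont M2.cdf_is_right_cont)
  have F_bot: "(F \<longlongrightarrow> 0) at_bot"
    unfolding F_def using tendsto_diff[OF M2.cdf_lim_at_bot M1.cdf_lim_at_bot] by simp
  have F_top: "(F \<longlongrightarrow> m) at_top"
    unfolding F_def m_def by (intro tendsto_diff M2.cdf_lim_at_top M1.cdf_lim_at_top)
  have "0 \<le> F x" for x
    by (rule tendsto_upperbound[OF F_bot])
      (auto simp: eventually_at_bot_linorder F_mono intro!: exI[of _ x])
  then have m: "0 \<le> m"
    by (intro tendsto_lowerbound[OF F_top]) auto
  have D: "finite_borel_measure D"
    unfolding D_def by (rule finite_borel_measure_interval_measure[OF F_mono F_right F_bot F_top m])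
  interpret D: finite_borel_measure D by fact
  have cdf_D: "cdf D = F"
    unfolding D_def by (rule cdf_interval_measure[OF F_mono F_right F_bot])
  \<comment> \<open>The sum of \<open>M1\<close> and \<open>D\<close> as a measure; it is \<open>M2\<close> because the cdf's agree.\<close>
  define S where "S = measure_of UNIV (sets borel) (\<lambda>A. emeasure M1 A + emeasure D A)"
  have sets_S: "sets S = sets borel" and space_S: "space S = UNIV"
    unfolding S_def by (simp_all add: sets.sigma_sets_eq[of borel, simplified])
  have emeasure_S: "emeasure S A = emeasure M1 A + emeasure D A" if "A \<in> sets borel" for A
  proof (rule emeasure_measure_of[OF S_def])
    show "countably_additive (sets S) (\<lambda>A. emeasure M1 A + emeasure D A)"
      unfolding countably_additive_def
    proof (intro allI impI)
      fix B :: "nat \<Rightarrow> real set"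
      assume "range B \<subseteq> sets S" "disjoint_family B"
      then have "(\<Sum>i. emeasure M1 (B i)) = emeasure M1 (\<Union>i. B i)"
        "(\<Sum>i. emeasure D (B i)) = emeasure D (\<Union>i. B i)"
        by (auto intro!: suminf_emeasure simp: sets_S M1.M_is_borel D.M_is_borel)
      then show "(\<Sum>i. emeasure M1 (B i) + emeasure D (B i)) =
          emeasure M1 (\<Union>i. B i) + emeasure D (\<Union>i. B i)"
        by (simp add: suminf_add[symmetric])
    qed
  qed (auto simp: positive_def sets_S that)
  have S: "finite_borel_measure S"
  proof (intro finite_borel_measure.intro finite_borel_measure_axioms.intro finite_measureI)
    show "emeasure S (space S) \<noteq> \<infinity>"
      by (simp add: emeasure_S space_S)
  qed (rule sets_S)
  have "cdf S x = cdf M2 x" for x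
  proof -
    have "measure S {..x} = measure M1 {..x} + measure D {..x}"
      by (simp add: measure_def emeasure_S enn2real_plus less_top[symmetric])
    then show ?thesis
      using cdf_D by (simp add: cdf_def F_def fun_eq_iff)
  qed
  then have "S = M2"
    by (intro cdf_unique' S M2) auto
  with emeasure_S D that show thesis by blast
qed

text \<open>
  The density of \<open>M2\<close> is that of \<open>M1\<close> plus that of the nonnegative remainder.
\<close>

lemma RN_deriv_le:
  assumes \<mu>: "real_distribution \<mu>"
    and M1: "finite_borel_measure M1" and M2: "finite_borel_measure M2"
    and mono: "mono (\<lambda>x. cdf M2 x - cdf M1 x)"
    and ac: "absolutely_continuous \<mu> M2"
  shows "absolutely_continuous \<mu> M1" and "AE x in \<mu>. RN_deriv \<mu> M1 x \<le> RN_deriv \<mu> M2 x"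
proof -
  interpret \<mu>: real_distribution \<mu> by fact
  interpret M1: finite_borel_measure M1 by fact
  interpret M2: finite_borel_measure M2 by fact
  obtain D where D: "finite_borel_measure D"
    and sum: "\<And>A. A \<in> sets borel \<Longrightarrow> emeasure M2 A = emeasure M1 A + emeasure D A"
    using finite_borel_measure_decompose[OF M1 M2 mono] by blast
  interpret D: finite_borel_measure D by fact
  show ac1: "absolutely_continuous \<mu> M1"
    using ac sum by (auto simp: absolutely_continuous_def null_sets_def M1.M_is_borel M2.M_is_borel)
  have acD: "absolutely_continuous \<mu> D"
    using ac sum by (auto simp: absolutely_continuous_def null_sets_def D.M_is_borel M2.M_is_borel)
  let ?k = "RN_deriv \<mu> M1" and ?d = "RN_deriv \<mu> D"
  have k: "density \<mu> ?k = M1" and d: "density \<mu> ?d = D"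
    using ac1 acD by (auto intro!: \<mu>.density_RN_deriv simp: M1.M_is_borel D.M_is_borel)
  have "density \<mu> (\<lambda>x. ?k x + ?d x) = M2"
  proof (rule measure_eqI)
    fix A assume "A \<in> sets (density \<mu> (\<lambda>x. ?k x + ?d x))"
    then have A: "A \<in> sets \<mu>" "A \<in> sets borel" by simp_all
    have "emeasure (density \<mu> (\<lambda>x. ?k x + ?d x)) A = emeasure (density \<mu> ?k) A + emeasure (density \<mu> ?d) A"
      using A by (simp add: emeasure_density distrib_right nn_integral_add)
    then show "emeasure (density \<mu> (\<lambda>x. ?k x + ?d x)) A = emeasure M2 A"
      using sum[OF A(2)] by (simp add: k d)
  qed (simp add: M2.M_is_borel)
  then have "AE x in \<mu>. ?k x + ?d x = RN_deriv \<mu> M2 x"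
    by (intro \<mu>.RN_deriv_unique) auto
  then show "AE x in \<mu>. ?k x \<le> RN_deriv \<mu> M2 x"
    by eventually_elim (metis add_increasing2 order_refl zero_le)
qed

lemma absolutely_continuous_of_cdf_increments_le:
  assumes M1: "finite_borel_measure M1" and M2: "finite_borel_measure M2"
    and mono: "mono (\<lambda>x. cdf M2 x - cdf M1 x)"
  shows "absolutely_continuous M2 M1"
proof -
  obtain D where "\<And>A. A \<in> sets borel \<Longrightarrow> emeasure M2 A = emeasure M1 A + emeasure D A"
    using finite_borel_measure_decompose[OF assms] by blast
  then show ?thesis
    using assms(1,2)[THEN finite_borel_measure.M_is_borel]
    by (auto simp: absolutely_continuous_def null_sets_def)
qed

section \<open>Joint distributions from 2-increasing functions\<close>

text \<open>
  A 2-increasing \<open>H\<close> with margins \<open>\<mu>\<close> and \<open>\<nu>\<close> is a joint cdf. The coupling is obtained by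
  disintegration along the first coordinate. For fixed \<open>y\<close>, the function \<open>\<lambda>x. H x y\<close> is the cdf of
  a measure \<open>M y \<le> \<mu>\<close>, namely the mass that has to end up in \<open>(-\<infinity>, y]\<close>; its density
  \<open>k y x\<close> is the conditional probability of \<open>(-\<infinity>, y]\<close> given \<open>x\<close>. These densities are
  monotone in \<open>y\<close> only up to null sets, so just countably many of them are compared at a time: from
  \<open>x\<close> and an independent uniform \<open>u\<close> the second coordinate is the generalized inverse \<open>T\<close> of
  \<open>\<lambda>q. k q x\<close> along the rationals, evaluated at \<open>u\<close>. Right continuity in each variable is
  inherited from the margins: the 2-increasing property bounds the increments of \<open>H\<close> by those
  of the marginal cdf's.
\<close>

lemma joint_distribution_exists:
  fixes H :: "real \<Rightarrow> real \<Rightarrow> real"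
  assumes \<mu>: "real_distribution \<mu>" and \<nu>: "real_distribution \<nu>"
    and rect: "\<And>x x' y y'. x \<le> x' \<Longrightarrow> y \<le> y' \<Longrightarrow> H x y' - H x y \<le> H x' y' - H x' y"
    and nonneg: "\<And>x y. 0 \<le> H x y"
    and le_\<mu>: "\<And>x y. H x y \<le> cdf \<mu> x" and le_\<nu>: "\<And>x y. H x y \<le> cdf \<nu> y"
    and lim_y: "\<And>x. (H x \<longlongrightarrow> cdf \<mu> x) at_top"
    and lim_x: "\<And>y. ((\<lambda>x. H x y) \<longlongrightarrow> cdf \<nu> y) at_top"
  shows "\<exists>P. prob_space P \<and> sets P = sets borel \<and> distr P borel fst = \<mu> \<and> distr P borel snd = \<nu>
    \<and> (\<forall>x y. measure P ({..x} \<times> {..y}) = H x y)"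
proof -
  interpret \<mu>: real_distribution \<mu> by fact
  interpret \<nu>: real_distribution \<nu> by fact

  \<comment> \<open>The 2-increasing property, with one edge of the rectangle sent to infinity, makes \<open>H\<close> monotone
    and bounds its increments by those of the margins.\<close>
  have bot_x: "((\<lambda>x. H x y) \<longlongrightarrow> 0) at_bot" for y
    by (rule tendsto_sandwich[OF _ _ tendsto_const \<mu>.cdf_lim_at_bot]) (simp_all add: nonneg le_\<mu>)
  have bot_y: "((\<lambda>y. H x y) \<longlongrightarrow> 0) at_bot" for x
    by (rule tendsto_sandwich[OF _ _ tendsto_const \<nu>.cdf_lim_at_bot]) (simp_all add: nonneg le_\<nu>)
  have mono_x: "H x y \<le> H x' y" if "x \<le> x'" for x x' y
  proof -
    have "H x y - 0 \<le> H x' y - 0"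
      by (rule tendsto_le[OF _ tendsto_diff[OF tendsto_const bot_y] tendsto_diff[OF tendsto_const bot_y]])
        (auto simp: eventually_at_bot_linorder intro!: exI[of _ y] rect that)
    then show ?thesis by simp
  qed
  have incr_x: "H x' y - H x y \<le> cdf \<mu> x' - cdf \<mu> x" if "x \<le> x'" for x x' y
  proof (rule tendsto_le[OF _ tendsto_diff[OF lim_y lim_y] tendsto_const])
    show "\<forall>\<^sub>F t in at_top. H x' y - H x y \<le> H x' t - H x t"
      using eventually_ge_at_top[of y] by eventually_elim (use rect[OF that] in \<open>simp add: algebra_simps\<close>)
  qed simp
  have incr_y: "H x y' - H x y \<le> cdf \<nu> y' - cdf \<nu> y" if "y \<le> y'" for x y y'
  proof (rule tendsto_le[OF _ tendsto_diff[OF lim_x lim_x] tendsto_const])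
    show "\<forall>\<^sub>F t in at_top. H x y' - H x y \<le> H t y' - H t y"
      using eventually_ge_at_top[of x] by eventually_elim (rule rect[OF _ that])
  qed simp
  have right_x: "continuous (at_right x) (\<lambda>x. H x y)" for x y
    unfolding continuous_within
  proof (rule tendsto_sandwich)
    show "\<forall>\<^sub>F t in at_right x. H x y \<le> H t y"
      using eventually_at_right_less[of x] by eventually_elim (simp add: mono_x)
    show "\<forall>\<^sub>F t in at_right x. H t y \<le> H x y + (cdf \<mu> t - cdf \<mu> x)"
      using eventually_at_right_less[of x]
    proof eventually_elim
      case (elim t) then show ?case using incr_x[of x t y] by simp
    qed
    have "((\<lambda>t. H x y + (cdf \<mu> t - cdf \<mu> x)) \<longlongrightarrow> H x y + (cdf \<mu> x - cdf \<mu> x)) (at_right x)"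
      by (intro tendsto_intros \<mu>.cdf_is_right_cont[unfolded continuous_within])
    then show "((\<lambda>t. H x y + (cdf \<mu> t - cdf \<mu> x)) \<longlongrightarrow> H x y) (at_right x)" by simp
  qed simp

  define M where "M y = interval_measure (\<lambda>x. H x y)" for y
  have fbm_M: "finite_borel_measure (M y)" for y
    unfolding M_def
    by (rule finite_borel_measure_interval_measure[OF _ right_x bot_x lim_x])
      (simp_all add: mono_x \<nu>.cdf_nonneg)
  have M_UNIV: "emeasure (M y) UNIV = cdf \<nu> y" for y
    unfolding M_def by (rule interval_measure_UNIV[OF _ right_x bot_x lim_x])
      (simp_all add: mono_x \<nu>.cdf_nonneg)
  have M_atMost: "emeasure (M y) {..x} = H x y" for x y
    unfolding M_def by (rule emeasure_interval_measure_Iic[OF _ right_x bot_x]) (simp add: mono_x)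
  have cdf_M: "cdf (M y) = (\<lambda>x. H x y)" for y
    unfolding M_def by (rule cdf_interval_measure[OF _ right_x bot_x]) (simp add: mono_x)
  have sets_M[simp]: "sets (M y) = sets borel" for y
    by (simp add: M_def)
  have mono_\<mu>_M: "mono (\<lambda>x. cdf \<mu> x - cdf (M y) x)" for y
    unfolding mono_def cdf_M
  proof (intro allI impI)
    fix x x' :: real assume "x \<le> x'"
    then show "cdf \<mu> x - H x y \<le> cdf \<mu> x' - H x' y" using incr_x[of x x' y] by simp
  qed
  have ac: "absolutely_continuous \<mu> (M y)" for y
    by (rule absolutely_continuous_of_cdf_increments_le[OF fbm_M \<mu>.finite_borel_measure_M mono_\<mu>_M])

  define k where "k y = RN_deriv \<mu> (M y)" for y
  have k_meas[measurable]: "k y \<in> borel_measurable borel" for y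
    unfolding k_def using borel_measurable_RN_deriv[of \<mu> "M y"] by simp
  have k_density: "density \<mu> (k y) = M y" for y
    unfolding k_def by (rule \<mu>.density_RN_deriv[OF ac]) simp
  have k_mono: "AE x in \<mu>. k y x \<le> k y' x" if "y \<le> y'" for y y'
    unfolding k_def
  proof (rule RN_deriv_le(2)[OF \<mu> fbm_M fbm_M _ ac])
    show "mono (\<lambda>x. cdf (M y') x - cdf (M y) x)"
      using rect[OF _ that] by (simp add: mono_def cdf_M)
  qed
  have k_le_1: "AE x in \<mu>. k y x \<le> 1" for y
  proof -
    have "AE x in \<mu>. k y x \<le> RN_deriv \<mu> \<mu> x"
      unfolding k_def
      by (rule RN_deriv_le(2)[OF \<mu> fbm_M \<mu>.finite_borel_measure_M mono_\<mu>_M])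
        (simp add: absolutely_continuous_def)
    moreover have "AE x in \<mu>. 1 = RN_deriv \<mu> \<mu> x"
      by (rule \<mu>.RN_deriv_unique) (simp_all add: density_1)
    ultimately show ?thesis by eventually_elim simp
  qed

  \<comment> \<open>The sample space carries \<open>x\<close> and an independent uniform \<open>u\<close>; the event \<open>L y\<close> has conditional
    probability \<open>k y x\<close> given \<open>x\<close>.\<close>
  define U where "U = uniform_measure lborel {0..1::real}"
  interpret U: prob_space U
    unfolding U_def by (rule prob_space_uniform_measure) simp_all
  have sets_U[measurable_cong, simp]: "sets U = sets borel"
    by (simp add: U_def)
  have space_U[simp]: "space U = UNIV"
    by (simp add: U_def)
  have U_below: "emeasure U {u. ennreal u \<le> c} = c" if c: "c \<le> 1" for c
  proof -
    obtain r where r: "c = ennreal r" "0 \<le> r" "r \<le> 1"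
      using c by (cases c) (auto simp: top_unique)
    have "{0..1} \<inter> {u. ennreal u \<le> c} = {0..r}"
      using r by auto
    moreover have "{u. ennreal u \<le> c} \<in> sets borel" by measurable
    ultimately show ?thesis
      unfolding U_def using r by (simp add: divide_ennreal_def)
  qed

  define N where "N = \<mu> \<Otimes>\<^sub>M U"
  interpret N: pair_prob_space \<mu> U ..
  interpret N: prob_space N unfolding N_def by (rule N.prob_space_axioms)
  have sets_N[measurable_cong, simp]: "sets N = sets (borel \<Otimes>\<^sub>M borel)"
    unfolding N_def by (intro sets_pair_measure_cong) simp_all
  have space_N[simp]: "space N = UNIV"
    by (simp add: N_def space_pair_measure)
  have distr_N_fst: "distr N \<mu> fst = \<mu>"
    unfolding N_def by (rule U.distr_pair_fst)
  have AE_N: "AE z in N. Q (fst z)" if "AE x in \<mu>. Q x" for Q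
  proof (rule AE_distrD[of fst N \<mu> Q])
    show "fst \<in> N \<rightarrow>\<^sub>M \<mu>" by (simp add: N_def)
    show "AE x in distr N \<mu> fst. Q x" using that by (simp only: distr_N_fst)
  qed

  define L where "L y = {z::real\<times>real. ennreal (snd z) \<le> k y (fst z)}" for y
  have L_meas[measurable]: "L y \<in> sets N" for y
  proof -
    have "{z \<in> space (borel \<Otimes>\<^sub>M borel). ennreal (snd z) \<le> k y (fst z)} \<in> sets (borel \<Otimes>\<^sub>M borel)"
      by measurable
    then show ?thesis by (simp add: L_def space_pair_measure)
  qed
  have N_L: "emeasure N ((A \<times> UNIV) \<inter> L y) = emeasure (M y) A" if A[measurable]: "A \<in> sets borel" for A y
  proof -
    have "emeasure N ((A \<times> UNIV) \<inter> L y) = (\<integral>\<^sup>+x. emeasure U (Pair x -` ((A \<times> UNIV) \<inter> L y)) \<partial>\<mu>)"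
      unfolding N_def
    proof (rule U.emeasure_pair_measure_alt)
      show "A \<times> UNIV \<inter> L y \<in> sets (\<mu> \<Otimes>\<^sub>M U)"
        unfolding N_def[symmetric] using A by measurable
    qed
    also have "\<dots> = (\<integral>\<^sup>+x. k y x * indicator A x \<partial>\<mu>)"
    proof (rule nn_integral_cong_AE)
      show "AE x in \<mu>. emeasure U (Pair x -` ((A \<times> UNIV) \<inter> L y)) = k y x * indicator A x"
        using k_le_1[of y]
      proof eventually_elim
        case (elim x)
        have "Pair x -` ((A \<times> UNIV) \<inter> L y) = (if x \<in> A then {u. ennreal u \<le> k y x} else {})"
          by (auto simp: L_def)
        then show ?case using U_below[OF elim] by simp
      qed
    qed
    also have "\<dots> = emeasure (density \<mu> (k y)) A"
      using A by (intro emeasure_density[symmetric]) simp_all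
    finally show ?thesis by (simp add: k_density)
  qed

  \<comment> \<open>Infinite values stand for an empty or unbounded index set. The events \<open>T \<le> y\<close> and \<open>L y\<close> agree only
    up to the right limit in \<open>y\<close>, hence the two one-sided statements \<open>T_le\<close> and \<open>T_le_imp\<close>.\<close>
  define T where "T z = (INF q\<in>\<rat>. if z \<in> L q then ereal q else \<infinity>)" for z
  have T_meas[measurable]: "T \<in> borel_measurable N"
    unfolding T_def by (intro borel_measurable_INF countable_rat measurable_If)
      (use L_meas in simp_all)
  have T_le: "AE z in N. z \<in> L y \<longrightarrow> T z \<le> ereal y" for y
  proof -
    have "AE x in \<mu>. \<forall>q\<in>\<rat>. y < q \<longrightarrow> k y x \<le> k q x"
      using k_mono[of y] by (auto simp: AE_ball_countable countable_rat AE_impI)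
    then have "AE z in N. \<forall>q\<in>\<rat>. y < q \<longrightarrow> k y (fst z) \<le> k q (fst z)"
      by (rule AE_N)
    then show ?thesis
    proof eventually_elim
      case (elim z)
      show ?case
      proof
        assume z: "z \<in> L y"
        show "T z \<le> ereal y"
        proof (rule ereal_le_epsilon2)
          fix e :: real assume "0 < e"
          then obtain q where q: "q \<in> \<rat>" "y < q" "q < y + e"
            using Rats_dense_in_real[of y "y + e"] by auto
          with elim z have "z \<in> L q"
            by (auto simp: L_def intro: order_trans)
          then have "T z \<le> ereal q"
            unfolding T_def by (intro INF_lower2[OF q(1)]) simp
          also have "\<dots> \<le> ereal y + ereal e" using q by simp
          finally show "T z \<le> ereal y + ereal e" .
        qed
      qed
    qed
  qed
  have T_le_imp: "AE z in N. T z \<le> ereal y \<longrightarrow> z \<in> L q" if "q \<in> \<rat>" "y < q" for y q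
  proof -
    have "AE x in \<mu>. \<forall>r\<in>\<rat>. r < q \<longrightarrow> k r x \<le> k q x"
      using k_mono[of _ q] by (auto simp: AE_ball_countable countable_rat AE_impI)
    then have "AE z in N. \<forall>r\<in>\<rat>. r < q \<longrightarrow> k r (fst z) \<le> k q (fst z)"
      by (rule AE_N)
    then show ?thesis
    proof eventually_elim
      case (elim z)
      show ?case
      proof
        assume "T z \<le> ereal y"
        also have "\<dots> < ereal q" using that by simp
        finally obtain r where "r \<in> \<rat>" "(if z \<in> L r then ereal r else \<infinity>) < ereal q"
          unfolding T_def INF_less_iff by blast
        with elim show "z \<in> L q"
          by (auto simp: L_def split: if_splits intro: order_trans)
      qed
    qed
  qed
  define J where "J A y = (A \<times> UNIV) \<inter> {z. T z \<le> ereal y}" for A :: "real set" and y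
  have J_meas[measurable]: "J A y \<in> sets N" if A[measurable]: "A \<in> sets borel" for A y
    unfolding J_def using A by measurable
  have J_lower: "emeasure (M y) A \<le> emeasure N (J A y)" if "A \<in> sets borel" for A y
    unfolding N_L[OF that, symmetric]
  proof (rule emeasure_mono_AE)
    show "AE z in N. z \<in> A \<times> UNIV \<inter> L y \<longrightarrow> z \<in> J A y"
      using T_le[of y] by eventually_elim (auto simp: J_def)
  qed (rule J_meas[OF that])
  have J_upper: "emeasure N (J A y) \<le> emeasure (M q) A" if "A \<in> sets borel" "q \<in> \<rat>" "y < q" for A y q
    unfolding N_L[OF that(1), symmetric]
  proof (rule emeasure_mono_AE)
    show "AE z in N. z \<in> J A y \<longrightarrow> z \<in> A \<times> UNIV \<inter> L q"
      using T_le_imp[OF that(2,3)] by eventually_elim (auto simp: J_def)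
    show "A \<times> UNIV \<inter> L q \<in> sets N"
      using that(1) by measurable
  qed
  \<comment> \<open>Right continuity of \<open>cdf \<nu>\<close> closes the gap between the bounds \<open>M y\<close> and \<open>M q\<close>, \<open>q > y\<close>.\<close>
  have approx: "\<exists>q\<in>\<rat>. y < q \<and> cdf \<nu> q \<le> cdf \<nu> y + e" if "0 < e" for e y
  proof -
    have "\<forall>\<^sub>F t in at_right y. cdf \<nu> t < cdf \<nu> y + e"
      using \<nu>.cdf_is_right_cont[of y] that by (auto simp: continuous_within intro: order_tendstoD)
    then obtain b where b: "b > y" "\<And>t. y < t \<Longrightarrow> t < b \<Longrightarrow> cdf \<nu> t < cdf \<nu> y + e"
      by (auto simp: eventually_at_right_field)
    obtain q where "q \<in> \<rat>" "y < q" "q < b"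
      using Rats_dense_in_real[OF b(1)] by auto
    then show ?thesis using b(2)[of q] by (auto intro: less_imp_le)
  qed
  have J_atMost: "measure N (J {..x} y) = H x y" for x y
  proof (rule antisym)
    show "H x y \<le> measure N (J {..x} y)"
      using J_lower[of "{..x}" y] by (simp add: M_atMost N.emeasure_eq_measure)
    show "measure N (J {..x} y) \<le> H x y"
    proof (rule field_le_epsilon)
      fix e :: real assume "0 < e"
      from approx[OF this, of y] obtain q where q: "q \<in> \<rat>" "y < q" "cdf \<nu> q \<le> cdf \<nu> y + e" by blast
      have "measure N (J {..x} y) \<le> H x q"
        using J_upper[of "{..x}" q y] q by (simp add: M_atMost N.emeasure_eq_measure nonneg)
      then show "measure N (J {..x} y) \<le> H x y + e"
        using incr_y[of y q x] q by simp
    qed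
  qed
  have J_UNIV: "measure N (J UNIV y) = cdf \<nu> y" for y
  proof (rule antisym)
    show "cdf \<nu> y \<le> measure N (J UNIV y)"
      using J_lower[of UNIV y] by (simp add: M_UNIV N.emeasure_eq_measure)
    show "measure N (J UNIV y) \<le> cdf \<nu> y"
    proof (rule field_le_epsilon)
      fix e :: real assume "0 < e"
      from approx[OF this, of y] obtain q where q: "q \<in> \<rat>" "y < q" "cdf \<nu> q \<le> cdf \<nu> y + e" by blast
      have "measure N (J UNIV y) \<le> cdf \<nu> q"
        using J_upper[of UNIV q y] q by (simp add: M_UNIV N.emeasure_eq_measure \<nu>.cdf_nonneg)
      then show "measure N (J UNIV y) \<le> cdf \<nu> y + e"
        using q by simp
    qed
  qed

  have T_finite: "AE z in N. \<bar>T z\<bar> \<noteq> \<infinity>"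
  proof -
    have "measure N {z. T z = -\<infinity>} \<le> 0"
    proof (rule tendsto_lowerbound[OF \<nu>.cdf_lim_at_bot])
      show "\<forall>\<^sub>F y in at_bot. measure N {z. T z = -\<infinity>} \<le> cdf \<nu> y"
        unfolding J_UNIV[symmetric]
        by (intro always_eventually allI N.finite_measure_mono J_meas) (auto simp: J_def)
    qed simp
    moreover have "measure N {z. T z = \<infinity>} \<le> 1 - 1"
    proof (rule tendsto_lowerbound[OF tendsto_diff[OF tendsto_const \<nu>.cdf_lim_at_top_prob]])
      have "measure N {z. T z = \<infinity>} \<le> measure N (space N - J UNIV y)" for y
        by (intro N.finite_measure_mono sets.compl_sets J_meas) (auto simp: J_def)
      also have "measure N (space N - J UNIV y) = 1 - cdf \<nu> y" for y
        by (subst N.prob_compl[OF J_meas]) (simp_all add: J_UNIV)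
      finally show "\<forall>\<^sub>F y in at_top. measure N {z. T z = \<infinity>} \<le> 1 - cdf \<nu> y"
        by simp
    qed simp
    moreover have "{z. T z = c} \<in> sets N" for c
    proof -
      have "{z \<in> space N. T z = c} \<in> sets N" by measurable
      then show ?thesis by simp
    qed
    ultimately have "{z. T z = -\<infinity>} \<in> null_sets N" "{z. T z = \<infinity>} \<in> null_sets N"
      by (auto simp: null_sets_def N.emeasure_eq_measure measure_le_0_iff)
    from this[THEN AE_not_in] show ?thesis by eventually_elim auto
  qed

  define f where "f z = (fst z, real_of_ereal (T z))" for z
  have f_meas[measurable]: "f \<in> N \<rightarrow>\<^sub>M borel"
    unfolding f_def borel_prod[symmetric] by measurable
  define P where "P = distr N borel f"
  interpret P: prob_space P
    unfolding P_def by (rule N.prob_space_distr) measurable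
  have f_iff_J: "AE z in N. f z \<in> A \<times> {..y} \<longleftrightarrow> z \<in> J A y" for A y
    using T_finite
  proof eventually_elim
    case (elim z)
    then obtain t where "T z = ereal t" by (cases "T z") auto
    then show ?case by (cases z) (auto simp: f_def J_def)
  qed
  have P_rect: "measure P (A \<times> {..y}) = measure N (J A y)" if "A \<in> sets borel" for A y
  proof -
    have A: "A \<times> {..y} \<in> sets borel" using that by (simp add: borel_prod[symmetric])
    then have "measure P (A \<times> {..y}) = measure N (f -` (A \<times> {..y}) \<inter> space N)"
      unfolding P_def by (intro measure_distr) simp_all
    also have "\<dots> = measure N (J A y)"
    proof (rule N.finite_measure_eq_AE)
      show "AE z in N. z \<in> f -` (A \<times> {..y}) \<inter> space N \<longleftrightarrow> z \<in> J A y"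
        using f_iff_J[of A y] by eventually_elim simp
    qed (rule measurable_sets[OF f_meas A], rule J_meas[OF that])
    finally show ?thesis .
  qed
  have "distr P borel fst = \<mu>"
  proof -
    have "distr P borel fst = distr N borel (fst \<circ> f)"
      unfolding P_def by (rule distr_distr[OF _ f_meas]) (simp add: borel_prod[symmetric])
    also have "fst \<circ> f = fst" by (auto simp: f_def)
    also have "distr N borel fst = distr N \<mu> fst" by (intro distr_cong) simp_all
    finally show ?thesis by (simp add: distr_N_fst)
  qed
  moreover have "distr P borel snd = \<nu>"
  proof (rule cdf_unique)
    have snd: "snd \<in> P \<rightarrow>\<^sub>M borel" by (simp add: P_def borel_prod[symmetric])
    show "real_distribution (distr P borel snd)" by (rule P.real_distribution_distr) fact
    have "measure (distr P borel snd) {..y} = measure P (UNIV \<times> {..y})" for y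
      by (subst measure_distr[OF snd]) (auto simp: P_def intro!: arg_cong[where f="measure _"])
    then show "cdf (distr P borel snd) = cdf \<nu>"
      by (simp add: cdf_def[of "distr P borel snd"] P_rect J_UNIV fun_eq_iff)
  qed fact
  moreover have "measure P ({..x} \<times> {..y}) = H x y" for x y
    by (simp add: P_rect J_atMost)
  ultimately show ?thesis
    using P.prob_space_axioms by (intro exI[of _ P]) (auto simp: P_def)
qed

section \<open>Directional couplings and their tails\<close>

lemma measure_eq_of_joint_cdf_eq:
  fixes P Q :: "(real \<times> real) measure"
  assumes P: "prob_space P" "sets P = sets borel" and Q: "prob_space Q" "sets Q = sets borel"
    and eq: "\<And>x y. measure P ({..x} \<times> {..y}) = measure Q ({..x} \<times> {..y})"
  shows "P = Q"
proof -
  interpret P: prob_space P by fact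
  interpret Q: prob_space Q by fact
  have atMost: "{..z} = {..fst z} \<times> {..snd z}" for z :: "real \<times> real"
    by (auto simp: less_eq_prod_def)
  have borel: "sets (borel :: (real \<times> real) measure) = sigma_sets UNIV (range atMost)"
    unfolding borel_eq_atMost by simp
  have eq': "emeasure P {..z} = emeasure Q {..z}" for z
    unfolding atMost by (simp add: P.emeasure_eq_measure Q.emeasure_eq_measure eq)
  have bdd: "\<exists>i::nat. a \<le> real i \<and> b \<le> real i" for a b
    using real_arch_simple[of "max a b"] by auto
  show ?thesis
  proof (rule measure_eqI_generator_eq[where E="range atMost" and \<Omega>=UNIV
        and A="\<lambda>i::nat. {..(real i, real i)}"])
    show "Int_stable (range (atMost :: real \<times> real \<Rightarrow> _))"
    proof (rule Int_stableI)
      fix a b assume "a \<in> range (atMost :: real \<times> real \<Rightarrow> _)" "b \<in> range (atMost :: real \<times> real \<Rightarrow> _)"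
      then obtain u v where "a = {..u}" "b = {..v}" by blast
      then have "a \<inter> b = {..inf u v}" by auto
      then show "a \<inter> b \<in> range atMost" by blast
    qed
    show "(\<Union>i. {..(real i, real i)}) = (UNIV :: (real \<times> real) set)"
      using bdd by (auto simp: less_eq_prod_def)
  qed (auto simp: P Q borel eq')
qed

lemma directional_couplingsD:
  assumes "P \<in> directional_couplings \<mu> \<nu>"
  shows "prob_space P" "sets P = sets borel" "distr P borel fst = \<mu>" "distr P borel snd = \<nu>"
    "AE z in P. fst z \<le> snd z"
  using assms by (auto simp: directional_couplings_def)

lemma sets_borel_times:
  "A \<in> sets borel \<Longrightarrow> B \<in> sets borel \<Longrightarrow> A \<times> B \<in> sets (borel :: (real \<times> real) measure)"
  by (simp add: borel_prod[symmetric])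

lemma emeasure_marginals:
  fixes P :: "(real \<times> real) measure"
  assumes P: "sets P = sets borel"
  shows "B \<in> sets borel \<Longrightarrow> emeasure (distr P borel fst) B = emeasure P (B \<times> UNIV)"
    and "B \<in> sets borel \<Longrightarrow> emeasure (distr P borel snd) B = emeasure P (UNIV \<times> B)"
proof -
  have sp: "space P = UNIV" using sets_eq_imp_space_eq[OF P] by simp
  have "fst \<in> P \<rightarrow>\<^sub>M borel" "snd \<in> P \<rightarrow>\<^sub>M borel"
    unfolding measurable_cong_sets[OF P refl] by (simp_all add: borel_prod[symmetric])
  then show "B \<in> sets borel \<Longrightarrow> emeasure (distr P borel fst) B = emeasure P (B \<times> UNIV)"
    "B \<in> sets borel \<Longrightarrow> emeasure (distr P borel snd) B = emeasure P (UNIV \<times> B)"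
    by (auto simp: emeasure_distr sp intro!: arg_cong[where f="emeasure P"])
qed

lemma measure_tail_rectangle:
  fixes P :: "(real \<times> real) measure"
  assumes P: "prob_space P" "sets P = sets borel"
  shows "measure P ({x<..} \<times> {..y}) = cdf (distr P borel snd) y - measure P ({..x} \<times> {..y})"
proof -
  interpret P: prob_space P by fact
  have "measure P (UNIV \<times> {..y}) = measure P ({..x} \<times> {..y}) + measure P ({x<..} \<times> {..y})"
    by (subst P.finite_measure_Union[symmetric])
      (auto simp: P sets_borel_times intro!: arg_cong[where f="measure P"])
  then show ?thesis
    using emeasure_marginals(2)[OF P(2), of "{..y}"] by (simp add: cdf_def measure_def)
qed

text \<open>
  The condition at \<open>r\<close> says that \<open>(r, \<infinity>) \<times> (-\<infinity>, r]\<close> is null, and the rational ones among these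
  quadrants cover the open half plane below the diagonal.
\<close>

lemma directional_couplingsI:
  assumes P: "prob_space P" "sets P = sets borel" "distr P borel fst = \<mu>" "distr P borel snd = \<nu>"
    and diag: "\<And>r. measure P ({..r} \<times> {..r}) = cdf \<nu> r"
  shows "P \<in> directional_couplings \<mu> \<nu>"
proof -
  interpret P: prob_space P by fact
  have "AE z in P. \<forall>r\<in>\<rat>. z \<notin> {r<..} \<times> {..r}"
  proof (subst AE_ball_countable[OF countable_rat], intro ballI)
    fix r :: real
    have "measure P ({r<..} \<times> {..r}) = 0"
      using measure_tail_rectangle[OF P(1,2)] by (simp add: P diag)
    then have "{r<..} \<times> {..r} \<in> null_sets P"
      by (auto simp: null_sets_def P P.emeasure_eq_measure sets_borel_times)
    then show "AE z in P. z \<notin> {r<..} \<times> {..r}" by (rule AE_not_in)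
  qed
  then have "AE z in P. fst z \<le> snd z"
  proof eventually_elim
    case (elim z)
    show ?case
    proof (rule ccontr)
      assume "\<not> fst z \<le> snd z"
      then obtain r where "r \<in> \<rat>" "snd z < r" "r < fst z"
        using Rats_dense_in_real[of "snd z" "fst z"] by auto
      with elim show False by (cases z) auto
    qed
  qed
  with P show ?thesis by (simp add: directional_couplings_def)
qed

text \<open>
  The image of the part of the first marginal lying in \<open>(x, \<infinity>)\<close>, that is, the measure
  \<open>\<lambda>B. P ({x<..} \<times> B)\<close> from the characterization of the optimal coupling.
\<close>

definition tail_marginal :: "(real \<times> real) measure \<Rightarrow> real \<Rightarrow> real measure" where
  "tail_marginal P x = distr (density P (indicator ({x<..} \<times> UNIV))) borel snd"

lemma sets_tail_marginal [simp]: "sets (tail_marginal P x) = sets borel"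
  and space_tail_marginal [simp]: "space (tail_marginal P x) = UNIV"
  by (simp_all add: tail_marginal_def)

lemma emeasure_tail_marginal:
  assumes P: "sets P = sets borel" and B: "B \<in> sets borel"
  shows "emeasure (tail_marginal P x) B = emeasure P ({x<..} \<times> B)"
proof -
  have sp: "space P = UNIV" using sets_eq_imp_space_eq[OF P] by simp
  have snd: "snd \<in> density P (indicator ({x<..} \<times> UNIV)) \<rightarrow>\<^sub>M borel"
    unfolding measurable_cong_sets[OF sets_density[of P, unfolded P] refl]
    by (simp add: borel_prod[symmetric])
  have "emeasure (tail_marginal P x) B = emeasure (density P (indicator ({x<..} \<times> UNIV))) (UNIV \<times> B)"
    unfolding tail_marginal_def
    by (subst emeasure_distr[OF snd B]) (auto simp: sp intro!: arg_cong[where f="emeasure _"])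
  also have "\<dots> = emeasure P (({x<..} \<times> UNIV) \<inter> (UNIV \<times> B))"
    by (rule emeasure_restricted) (simp_all add: P B sets_borel_times)
  also have "({x<..} \<times> UNIV) \<inter> (UNIV \<times> B) = {x<..} \<times> B" by auto
  finally show ?thesis .
qed

lemma measure_tail_marginal:
  assumes "sets P = sets borel" "B \<in> sets borel"
  shows "measure (tail_marginal P x) B = measure P ({x<..} \<times> B)"
  by (simp add: measure_def emeasure_tail_marginal assms)

lemma finite_borel_measure_tail_marginal:
  assumes P: "prob_space P" "sets P = sets borel"
  shows "finite_borel_measure (tail_marginal P x)"
proof -
  interpret P: prob_space P by fact
  show ?thesis
    by (intro finite_borel_measure.intro finite_borel_measure_axioms.intro finite_measureI)
      (simp_all add: emeasure_tail_marginal[OF P(2)])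
qed

lemma (in real_distribution) emeasure_tail_density:
  assumes "A \<in> sets borel"
  shows "emeasure (density M (indicator {x<..})) A = emeasure M ({x<..} \<inter> A)"
  using assms by (intro emeasure_restricted) simp_all

lemma (in real_distribution) cdf_tail_density:
  "cdf (density M (indicator {x<..})) t = max 0 (cdf M t - cdf M x)"
proof (cases "x < t")
  case True
  have "{x<..} \<inter> {..t} = {x<..t}" by auto
  then have "cdf (density M (indicator {x<..})) t = measure M {x<..t}"
    by (simp add: cdf_def measure_def emeasure_tail_density)
  then show ?thesis
    using cdf_diff_eq[OF True] by (simp add: max_def)
next
  case False
  then have "{x<..} \<inter> {..t} = {}" by auto
  then have "cdf (density M (indicator {x<..})) t = 0"
    by (simp add: cdf_def measure_def emeasure_tail_density)
  then show ?thesis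
    using cdf_nondecreasing[of t x] False by (simp add: max_def)
qed

text \<open>
  Directionality enters through the stochastic order: mass that starts in \<open>(x, \<infinity>)\<close> and ends
  in \<open>(-\<infinity>, t]\<close> must have started in \<open>(x, t]\<close>.
\<close>

lemma tail_marginal_admissible:
  assumes \<mu>: "real_distribution \<mu>" and \<nu>: "real_distribution \<nu>"
    and P: "P \<in> directional_couplings \<mu> \<nu>"
  shows "tail_marginal P x \<in> admissible_targets \<mu> \<nu> x"
proof -
  interpret \<mu>: real_distribution \<mu> by fact
  interpret \<nu>: real_distribution \<nu> by fact
  note PD = directional_couplingsD[OF P]
  interpret P: prob_space P by fact
  note marg = emeasure_marginals[OF PD(2), unfolded PD(3,4)]
  note tail = emeasure_tail_marginal[OF PD(2)]
  have "measure (density \<mu> (indicator {x<..})) UNIV = measure (tail_marginal P x) UNIV"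
    by (simp add: measure_def \<mu>.emeasure_tail_density tail marg)
  moreover have "cdf (tail_marginal P x) t \<le> cdf (density \<mu> (indicator {x<..})) t" for t
  proof -
    have "emeasure P ({x<..} \<times> {..t}) \<le> emeasure P (({x<..} \<inter> {..t}) \<times> UNIV)"
    proof (rule emeasure_mono_AE)
      show "AE z in P. z \<in> {x<..} \<times> {..t} \<longrightarrow> z \<in> ({x<..} \<inter> {..t}) \<times> UNIV"
        using PD(5) by eventually_elim auto
    qed (simp add: PD sets_borel_times)
    also have "\<dots> = emeasure (density \<mu> (indicator {x<..})) {..t}"
      by (simp add: \<mu>.emeasure_tail_density marg)
    finally show ?thesis
      by (auto simp: cdf_def measure_def tail \<mu>.emeasure_tail_density intro!: enn2real_mono
          simp: less_top[symmetric])
  qed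
  moreover have "tail_marginal P x \<le> \<nu>"
  proof -
    have sets: "sets (tail_marginal P x) = sets \<nu>" by simp
    have "emeasure (tail_marginal P x) A \<le> emeasure \<nu> A" if "A \<in> sets borel" for A
      unfolding tail[OF that] marg[OF that]
      by (rule emeasure_mono) (auto simp: PD sets_borel_times that)
    then show ?thesis
      by (auto simp: le_measure[OF sets] sets)
  qed
  ultimately show ?thesis
    by (simp add: admissible_targets_def st_le_def finite_borel_measure_tail_marginal PD)
qed

section \<open>The cdf of the optimal directional coupling\<close>

text \<open>
  The formula \<open>cdf \<mu> x - (INF z\<in>{x..y}. cdf \<mu> z - cdf \<nu> z)\<close>, valid for \<open>x \<le> y\<close>, and the value
  \<open>cdf \<nu> y\<close>, valid for \<open>y < x\<close>, in one expression. The absence of a case distinction is what keeps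
  the proof of the 2-increasing property short.
\<close>

definition transport_cdf :: "real measure \<Rightarrow> real measure \<Rightarrow> real \<Rightarrow> real \<Rightarrow> real" where
  "transport_cdf \<mu> \<nu> x y = (SUP z\<in>{..y}. cdf \<nu> z - max 0 (cdf \<mu> z - cdf \<mu> x))"

lemma transport_cdf_upper:
  assumes \<nu>: "real_distribution \<nu>" and "z \<le> y"
  shows "cdf \<nu> z - max 0 (cdf \<mu> z - cdf \<mu> x) \<le> transport_cdf \<mu> \<nu> x y"
  unfolding transport_cdf_def
proof (rule cSUP_upper)
  show "bdd_above ((\<lambda>z. cdf \<nu> z - max 0 (cdf \<mu> z - cdf \<mu> x)) ` {..y})"
  proof (rule bdd_aboveI2)
    fix z show "cdf \<nu> z - max 0 (cdf \<mu> z - cdf \<mu> x) \<le> 1"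
      using real_distribution.cdf_bounded_prob[OF \<nu>, of z] by simp
  qed
qed (use assms in simp)

lemma transport_cdf_least:
  assumes "\<And>z. z \<le> y \<Longrightarrow> cdf \<nu> z - max 0 (cdf \<mu> z - cdf \<mu> x) \<le> c"
  shows "transport_cdf \<mu> \<nu> x y \<le> c"
  unfolding transport_cdf_def using assms by (intro cSUP_least) auto

locale st_ordered = \<mu>: real_distribution \<mu> + \<nu>: real_distribution \<nu> for \<mu> \<nu> +
  assumes cdf_le: "cdf \<nu> t \<le> cdf \<mu> t"
begin

abbreviation H where "H \<equiv> transport_cdf \<mu> \<nu>"

lemma real_distributions: "real_distribution \<mu>" "real_distribution \<nu>" ..

lemmas H_upper = transport_cdf_upper[OF real_distributions(2)]

lemma H_nonneg: "0 \<le> H x y"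
proof -
  have "cdf \<mu> (min x y) \<le> cdf \<mu> x" by (rule \<mu>.cdf_nondecreasing) simp
  then show ?thesis
    using H_upper[of "min x y" y \<mu> x] \<nu>.cdf_nonneg[of "min x y"] by simp
qed

lemma H_le_first: "H x y \<le> cdf \<mu> x"
proof (rule transport_cdf_least)
  fix z show "cdf \<nu> z - max 0 (cdf \<mu> z - cdf \<mu> x) \<le> cdf \<mu> x"
    using cdf_le[of z] by simp
qed

lemma H_le_second: "H x y \<le> cdf \<nu> y"
  by (rule transport_cdf_least) (use \<nu>.cdf_nondecreasing in \<open>fastforce simp: max_def\<close>)

lemma H_below_diagonal: "y \<le> x \<Longrightarrow> H x y = cdf \<nu> y"
  using H_upper[of y y \<mu> x] \<mu>.cdf_nondecreasing[of y x] H_le_second[of x y] by simp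

text \<open>
  Take \<open>z \<le> y'\<close> and \<open>w \<le> y\<close> nearly optimal for \<open>H x y'\<close> and \<open>H x' y\<close>. If \<open>z \<le> y\<close>, then \<open>z\<close> also competes
  in \<open>H x y\<close> and \<open>w\<close> in \<open>H x' y'\<close>. Otherwise \<open>w \<le> z\<close>; assign \<open>z\<close> to \<open>H x' y'\<close> and \<open>w\<close> to \<open>H x y\<close>. The
  exchange does not decrease the total because, by convexity of the positive part, the increment of
  \<open>\<lambda>t. max 0 (cdf \<mu> t - c)\<close> from \<open>w\<close> to \<open>z\<close> decreases in \<open>c\<close>.
\<close>

lemma H_2_increasing:
  assumes "x \<le> x'" "y \<le> y'"
  shows "H x y' - H x y \<le> H x' y' - H x' y"
proof -
  have *: "(cdf \<nu> z - max 0 (cdf \<mu> z - cdf \<mu> x)) + (cdf \<nu> w - max 0 (cdf \<mu> w - cdf \<mu> x'))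
      \<le> H x' y' + H x y" if "z \<le> y'" "w \<le> y" for z w
  proof (cases "z \<le> y")
    case True
    then show ?thesis
      using H_upper[of z y \<mu> x] H_upper[of w y' \<mu> x'] that assms by simp
  next
    case False
    have "cdf \<mu> w \<le> cdf \<mu> z" "cdf \<mu> x \<le> cdf \<mu> x'"
      using False that assms by (auto intro!: \<mu>.cdf_nondecreasing)
    then show ?thesis
      using H_upper[of z y' \<mu> x'] H_upper[of w y \<mu> x] that by (simp add: max_def split: if_splits)
  qed
  have "H x' y \<le> H x' y' + H x y - (cdf \<nu> z - max 0 (cdf \<mu> z - cdf \<mu> x))" if "z \<le> y'" for z
    by (rule transport_cdf_least) (use *[OF that] in \<open>simp add: algebra_simps\<close>)
  then have "H x y' \<le> H x' y' + H x y - H x' y"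
    by (intro transport_cdf_least) (simp add: algebra_simps)
  then show ?thesis by simp
qed

lemma H_lim_second: "(H x \<longlongrightarrow> cdf \<mu> x) at_top"
proof (rule tendsto_sandwich)
  show "\<forall>\<^sub>F y in at_top. cdf \<nu> y - max 0 (cdf \<mu> y - cdf \<mu> x) \<le> H x y"
    by (simp add: H_upper)
  show "\<forall>\<^sub>F y in at_top. H x y \<le> cdf \<mu> x"
    by (simp add: H_le_first)
  have "((\<lambda>y. cdf \<nu> y - max 0 (cdf \<mu> y - cdf \<mu> x)) \<longlongrightarrow> 1 - max 0 (1 - cdf \<mu> x)) at_top"
    by (intro tendsto_intros \<mu>.cdf_lim_at_top_prob \<nu>.cdf_lim_at_top_prob)
  then show "((\<lambda>y. cdf \<nu> y - max 0 (cdf \<mu> y - cdf \<mu> x)) \<longlongrightarrow> cdf \<mu> x) at_top"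
    using \<mu>.cdf_bounded_prob[of x] by simp
qed simp

lemma H_lim_first: "((\<lambda>x. H x y) \<longlongrightarrow> cdf \<nu> y) at_top"
  by (rule tendsto_eventually)
    (auto simp: eventually_at_top_linorder H_below_diagonal intro!: exI[of _ y])

lemma directional_coupling_with_H:
  obtains P where "P \<in> directional_couplings \<mu> \<nu>" "\<And>x y. measure P ({..x} \<times> {..y}) = H x y"
proof -
  obtain P where P: "prob_space P" "sets P = sets borel" "distr P borel fst = \<mu>"
    "distr P borel snd = \<nu>" "\<And>x y. measure P ({..x} \<times> {..y}) = H x y"
    using joint_distribution_exists[OF real_distributions H_2_increasing H_nonneg H_le_first
        H_le_second H_lim_second H_lim_first] by blast
  have "P \<in> directional_couplings \<mu> \<nu>"
    by (rule directional_couplingsI) (simp_all add: P H_below_diagonal)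
  with P(5) that show thesis by blast
qed

text \<open>
  The comonotone coupling pairs equal quantiles, and under \<open>\<mu> \<preceq>\<^sub>s\<^sub>t \<nu>\<close> quantiles only move to the right.
\<close>

lemma comonotone_directional_coupling:
  obtains P where "P \<in> directional_couplings \<mu> \<nu>" "\<And>x y. measure P ({..x} \<times> {..y}) = H_vee \<mu> \<nu> x y"
proof -
  have "min (cdf \<mu> x) (cdf \<nu> y') - min (cdf \<mu> x) (cdf \<nu> y) \<le>
      min (cdf \<mu> x') (cdf \<nu> y') - min (cdf \<mu> x') (cdf \<nu> y)" if "x \<le> x'" "y \<le> y'" for x x' y y'
    using \<mu>.cdf_nondecreasing[OF that(1)] \<nu>.cdf_nondecreasing[OF that(2)] by (simp add: min_def)
  moreover have "((\<lambda>y. min (cdf \<mu> x) (cdf \<nu> y)) \<longlongrightarrow> min (cdf \<mu> x) 1) at_top" for x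
    by (intro tendsto_intros \<nu>.cdf_lim_at_top_prob)
  then have "((\<lambda>y. min (cdf \<mu> x) (cdf \<nu> y)) \<longlongrightarrow> cdf \<mu> x) at_top" for x
    by (simp add: min_absorb1 \<mu>.cdf_bounded_prob)
  moreover have "((\<lambda>x. min (cdf \<mu> x) (cdf \<nu> y)) \<longlongrightarrow> min 1 (cdf \<nu> y)) at_top" for y
    by (intro tendsto_intros \<mu>.cdf_lim_at_top_prob)
  then have "((\<lambda>x. min (cdf \<mu> x) (cdf \<nu> y)) \<longlongrightarrow> cdf \<nu> y) at_top" for y
    by (simp add: min_absorb2 \<nu>.cdf_bounded_prob)
  ultimately obtain P where P: "prob_space P" "sets P = sets borel" "distr P borel fst = \<mu>"
    "distr P borel snd = \<nu>" "\<And>x y. measure P ({..x} \<times> {..y}) = min (cdf \<mu> x) (cdf \<nu> y)"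
    using joint_distribution_exists[OF real_distributions, of "\<lambda>x y. min (cdf \<mu> x) (cdf \<nu> y)"]
      \<mu>.cdf_nonneg \<nu>.cdf_nonneg by auto
  have "P \<in> directional_couplings \<mu> \<nu>"
    by (rule directional_couplingsI) (simp_all add: P min_absorb2 cdf_le)
  with P(5) that show thesis by (simp add: H_vee_def)
qed

text \<open>
  Compare \<open>\<theta>\<close> with \<open>\<mu>\<close> on \<open>(-\<infinity>, z]\<close> by stochastic order and with \<open>\<nu>\<close> on \<open>(z, y]\<close> by domination, then
  optimize over \<open>z\<close>.
\<close>

lemma admissible_cdf_le:
  assumes "\<theta> \<in> admissible_targets \<mu> \<nu> x"
  shows "cdf \<theta> y \<le> cdf \<nu> y - H x y"
proof -
  interpret \<theta>: finite_borel_measure \<theta>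
    using assms by (simp add: admissible_targets_def)
  have st: "density \<mu> (indicator {x<..}) \<preceq>\<^sub>s\<^sub>t \<theta>" and le: "\<theta> \<le> \<nu>"
    using assms by (simp_all add: admissible_targets_def)
  have "H x y \<le> cdf \<nu> y - cdf \<theta> y"
  proof (rule transport_cdf_least)
    fix z assume z: "z \<le> y"
    have "cdf \<theta> z \<le> max 0 (cdf \<mu> z - cdf \<mu> x)"
      using st by (simp add: st_le_def \<mu>.cdf_tail_density)
    moreover have "emeasure \<theta> {z<..y} \<le> emeasure \<nu> {z<..y}"
      by (rule le_measureD3[OF le]) (simp add: \<theta>.M_is_borel)
    then have "cdf \<theta> y - cdf \<theta> z \<le> cdf \<nu> y - cdf \<nu> z"
      using \<theta>.emeasure_Ioc[OF z] \<nu>.emeasure_Ioc[OF z] \<nu>.cdf_nondecreasing[OF z] by simp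
    ultimately show "cdf \<nu> z - max 0 (cdf \<mu> z - cdf \<mu> x) \<le> cdf \<nu> y - cdf \<theta> y"
      by simp
  qed
  then show ?thesis by simp
qed

lemma cdf_tail_marginal:
  assumes "P \<in> directional_couplings \<mu> \<nu>"
  shows "cdf (tail_marginal P x) y = cdf \<nu> y - measure P ({..x} \<times> {..y})"
  using directional_couplingsD[OF assms]
  by (simp add: cdf_def[of "tail_marginal P x"] measure_tail_marginal measure_tail_rectangle)

text \<open>
  \<open>H\<close> is the least cdf of a directional coupling, since the tails of every such coupling are admissible.
\<close>

lemma H_le_coupling:
  assumes P: "P \<in> directional_couplings \<mu> \<nu>"
  shows "H x y \<le> measure P ({..x} \<times> {..y})"
  using admissible_cdf_le[OF tail_marginal_admissible[OF real_distributions P], of x y]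
  by (simp add: cdf_tail_marginal[OF P])

lemma coupling_le_H_vee:
  assumes P: "P \<in> directional_couplings \<mu> \<nu>"
  shows "measure P ({..x} \<times> {..y}) \<le> H_vee \<mu> \<nu> x y"
proof -
  note PD = directional_couplingsD[OF P]
  interpret P: prob_space P by fact
  have "measure P ({..x} \<times> {..y}) \<le> measure P ({..x} \<times> UNIV)"
    "measure P ({..x} \<times> {..y}) \<le> measure P (UNIV \<times> {..y})"
    by (auto intro!: P.finite_measure_mono simp: PD sets_borel_times)
  then show ?thesis
    using emeasure_marginals[OF PD(2), unfolded PD(3,4)]
    by (simp add: H_vee_def cdf_def measure_def)
qed

text \<open>
  A coupling with cdf \<open>H\<close> attains the bound \<open>admissible_cdf_le\<close> for every \<open>y\<close> at once. Its tail is thus a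
  least admissible target, and a least element is the only minimal one.
\<close>

lemma tail_target_eq:
  assumes P: "P \<in> directional_couplings \<mu> \<nu>" and PH: "\<And>x y. measure P ({..x} \<times> {..y}) = H x y"
  shows "tail_target \<mu> \<nu> x = tail_marginal P x"
proof -
  let ?\<theta> = "tail_marginal P x"
  have adm: "?\<theta> \<in> admissible_targets \<mu> \<nu> x"
    by (rule tail_marginal_admissible[OF real_distributions P])
  have least: "?\<theta> \<preceq>\<^sub>s\<^sub>t \<theta>" if "\<theta> \<in> admissible_targets \<mu> \<nu> x" for \<theta>
    using that adm admissible_cdf_le[OF that]
    by (simp add: st_le_def admissible_targets_def cdf_tail_marginal[OF P] PH)
  have antisym: "\<theta> = ?\<theta>" if "\<theta> \<in> admissible_targets \<mu> \<nu> x" "\<theta> \<preceq>\<^sub>s\<^sub>t ?\<theta>" for \<theta>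
  proof (rule cdf_unique')
    show "cdf \<theta> = cdf ?\<theta>"
      using that(2) least[OF that(1)] by (auto simp: st_le_def fun_eq_iff intro!: antisym)
  qed (use that adm in \<open>simp_all add: admissible_targets_def\<close>)
  show ?thesis
    unfolding tail_target_def
  proof (rule the_equality)
    fix \<theta> assume "\<theta> \<in> admissible_targets \<mu> \<nu> x \<and>
      (\<forall>\<theta>'\<in>admissible_targets \<mu> \<nu> x. \<theta>' \<preceq>\<^sub>s\<^sub>t \<theta> \<longrightarrow> \<theta>' = \<theta>)"
    then show "\<theta> = ?\<theta>" using adm least by blast
  qed (use adm antisym in blast)
qed

lemma optimal_coupling_eq:
  assumes P: "P \<in> directional_couplings \<mu> \<nu>" and PH: "\<And>x y. measure P ({..x} \<times> {..y}) = H x y"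
  shows "optimal_coupling \<mu> \<nu> = P"
  unfolding optimal_coupling_def tail_target_eq[OF P PH]
proof (rule the_equality)
  show "P \<in> directional_couplings \<mu> \<nu> \<and>
    (\<forall>x. \<forall>B\<in>sets borel. measure P ({x<..} \<times> B) = measure (tail_marginal P x) B)"
    using P directional_couplingsD(2)[OF P] by (simp add: measure_tail_marginal)
next
  fix Q assume "Q \<in> directional_couplings \<mu> \<nu> \<and>
    (\<forall>x. \<forall>B\<in>sets borel. measure Q ({x<..} \<times> B) = measure (tail_marginal P x) B)"
  then have Q: "Q \<in> directional_couplings \<mu> \<nu>"
    and eq: "\<And>x B. B \<in> sets borel \<Longrightarrow> measure Q ({x<..} \<times> B) = measure (tail_marginal P x) B"
    by auto
  note PD = directional_couplingsD[OF P] and QD = directional_couplingsD[OF Q]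
  have "measure Q ({..x} \<times> {..y}) = measure P ({..x} \<times> {..y})" for x y
    using eq[of "{..y}" x] measure_tail_rectangle[OF PD(1,2), of x y]
      measure_tail_rectangle[OF QD(1,2), of x y]
    by (simp add: measure_tail_marginal PD QD)
  then show "Q = P"
    by (intro measure_eq_of_joint_cdf_eq PD QD)
qed

lemma optimal_coupling_in: "optimal_coupling \<mu> \<nu> \<in> directional_couplings \<mu> \<nu>"
  by (metis directional_coupling_with_H optimal_coupling_eq)

lemma optimal_cdf_eq: "optimal_cdf \<mu> \<nu> = H"
proof -
  obtain P where P: "P \<in> directional_couplings \<mu> \<nu>" "\<And>x y. measure P ({..x} \<times> {..y}) = H x y"
    using directional_coupling_with_H by blast
  then show ?thesis
    by (simp add: fun_eq_iff optimal_cdf_def optimal_coupling_eq[OF P])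
qed

section \<open>Equality with the bounds\<close>

text \<open>
  \<open>H_wedge\<close> is the supremum that defines \<open>H\<close>, restricted to \<open>z = y\<close> and \<open>z = min x y\<close>.
\<close>

lemma H_wedge_le_H: "H_wedge \<mu> \<nu> x y \<le> H x y"
proof (cases "x \<le> y")
  case True
  then show ?thesis
    using H_upper[of x y \<mu> x] H_upper[of y y \<mu> x] \<mu>.cdf_nondecreasing[OF True] \<nu>.cdf_nondecreasing[OF True]
    by (simp add: H_wedge_def min_def)
next
  case False
  then show ?thesis
    using \<nu>.cdf_nondecreasing[of y x] \<mu>.cdf_nondecreasing[of y x]
    by (simp add: H_wedge_def H_below_diagonal)
qed

lemma H_eq_H_wedge_iff:
  "H = H_wedge \<mu> \<nu> \<longleftrightarrow>
    (\<forall>x z y. x \<le> z \<longrightarrow> z \<le> y \<longrightarrow> min (cdf \<mu> x - cdf \<nu> x) (cdf \<mu> y - cdf \<nu> y) \<le> cdf \<mu> z - cdf \<nu> z)"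
    (is "?L \<longleftrightarrow> ?R")
proof
  assume ?L
  show ?R
  proof (intro allI impI)
    fix x z y :: real assume xz: "x \<le> z" and zy: "z \<le> y"
    have "cdf \<nu> z - max 0 (cdf \<mu> z - cdf \<mu> x) \<le> H_wedge \<mu> \<nu> x y"
      using H_upper[OF zy] \<open>?L\<close> by metis
    then show "min (cdf \<mu> x - cdf \<nu> x) (cdf \<mu> y - cdf \<nu> y) \<le> cdf \<mu> z - cdf \<nu> z"
      using \<mu>.cdf_nondecreasing[OF xz] \<mu>.cdf_nondecreasing[OF zy]
        \<nu>.cdf_nondecreasing[OF xz] \<nu>.cdf_nondecreasing[OF zy]
      by (simp add: H_wedge_def min_def max_def split: if_splits)
  qed
next
  assume R: ?R
  have "H x y \<le> H_wedge \<mu> \<nu> x y" for x y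
  proof (rule transport_cdf_least)
    fix z assume zy: "z \<le> y"
    show "cdf \<nu> z - max 0 (cdf \<mu> z - cdf \<mu> x) \<le> H_wedge \<mu> \<nu> x y"
    proof (cases "x \<le> z")
      case True
      have "min (cdf \<mu> x - cdf \<nu> x) (cdf \<mu> y - cdf \<nu> y) \<le> cdf \<mu> z - cdf \<nu> z"
        using R True zy by blast
      then show ?thesis
        using \<mu>.cdf_nondecreasing[OF True] \<mu>.cdf_nondecreasing[OF zy]
          \<nu>.cdf_nondecreasing[OF True] \<nu>.cdf_nondecreasing[OF zy]
        by (simp add: H_wedge_def min_def max_def split: if_splits)
    next
      case False
      then show ?thesis
        using \<mu>.cdf_nondecreasing[of z x] \<nu>.cdf_nondecreasing[of z x] \<nu>.cdf_nondecreasing[OF zy]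
        by (simp add: H_wedge_def min_def max_def)
    qed
  qed
  then show ?L by (intro ext antisym H_wedge_le_H)
qed

text \<open>
  Both bounds are cdf's of directional couplings, so a single coupling identifies them; and if
  they coincide, every directional coupling has the same cdf, squeezed between \<open>H\<close> and \<open>H_vee\<close>.
\<close>

lemma H_eq_H_vee_iff_singleton:
  "H = H_vee \<mu> \<nu> \<longleftrightarrow> is_singleton (directional_couplings \<mu> \<nu>)"
proof
  assume eq: "H = H_vee \<mu> \<nu>"
  have "P = optimal_coupling \<mu> \<nu>" if P: "P \<in> directional_couplings \<mu> \<nu>" for P
  proof -
    have "measure P ({..x} \<times> {..y}) = H x y" for x y
      using H_le_coupling[OF P] coupling_le_H_vee[OF P] eq by (intro antisym) simp_all
    then show ?thesis using optimal_coupling_eq[OF P] by simp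
  qed
  then show "is_singleton (directional_couplings \<mu> \<nu>)"
    using optimal_coupling_in by (intro is_singletonI') auto
next
  assume *: "is_singleton (directional_couplings \<mu> \<nu>)"
  obtain P where P: "P \<in> directional_couplings \<mu> \<nu>" "\<And>x y. measure P ({..x} \<times> {..y}) = H x y"
    using directional_coupling_with_H by blast
  obtain Q where Q: "Q \<in> directional_couplings \<mu> \<nu>" "\<And>x y. measure Q ({..x} \<times> {..y}) = H_vee \<mu> \<nu> x y"
    using comonotone_directional_coupling by blast
  have "P = Q" using * P(1) Q(1) by (auto simp: is_singleton_def)
  then show "H = H_vee \<mu> \<nu>" using P(2) Q(2) by (simp add: fun_eq_iff)
qed

text \<open>
  An excursion of \<open>F = cdf \<mu> - cdf \<nu>\<close> above \<open>h > 0\<close> that starts and ends at height exactly \<open>h\<close> contradicts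
  \<open>H = H_vee\<close>. If \<open>[x, y]\<close> is the excursion interval, all competitors in \<open>H x y\<close> are at most
  \<open>cdf \<mu> x - h\<close>, so \<open>H_vee x y = cdf \<nu> y \<le> cdf \<mu> x - h\<close>. As \<open>cdf \<nu> y = cdf \<mu> y - h\<close> and
  \<open>cdf \<nu> x = cdf \<mu> x - h\<close>, neither cdf grows on \<open>[x, y]\<close> and \<open>F\<close> is constant there. Continuity is what
  makes an excursion start and end at its own level rather than by a jump.
\<close>

lemma H_eq_H_vee_iff_eq:
  assumes cont: "continuous_on UNIV (\<lambda>t. cdf \<mu> t - cdf \<nu> t)"
  shows "H = H_vee \<mu> \<nu> \<longleftrightarrow> \<mu> = \<nu>"
proof
  assume "\<mu> = \<nu>"
  show "H = H_vee \<mu> \<nu>"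
  proof (intro ext)
    fix x y
    show "H x y = H_vee \<mu> \<nu> x y"
    proof (cases "x \<le> y")
      case True
      then show ?thesis
        using H_upper[of x y \<mu> x] H_le_first[of x y] \<mu>.cdf_nondecreasing[OF True]
        by (simp add: H_vee_def \<open>\<mu> = \<nu>\<close>)
    next
      case False
      then show ?thesis
        using \<mu>.cdf_nondecreasing[of y x] H_below_diagonal[of y x] by (simp add: H_vee_def \<open>\<mu> = \<nu>\<close>)
    qed
  qed
next
  assume eq: "H = H_vee \<mu> \<nu>"
  define F where "F t = cdf \<mu> t - cdf \<nu> t" for t
  have cont_F: "continuous_on A F" for A
    using cont continuous_on_subset unfolding F_def by blast
  have bot: "(F \<longlongrightarrow> 0) at_bot" and top: "(F \<longlongrightarrow> 0) at_top"
    unfolding F_def using tendsto_diff[OF \<mu>.cdf_lim_at_bot \<nu>.cdf_lim_at_bot]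
      tendsto_diff[OF \<mu>.cdf_lim_at_top_prob \<nu>.cdf_lim_at_top_prob] by simp_all
  have "F p \<le> 0" for p
  proof (rule ccontr)
    assume "\<not> F p \<le> 0"
    define h where "h = F p / 2"
    have h: "0 < h" "h < F p" using \<open>\<not> F p \<le> 0\<close> by (auto simp: h_def)
    have closed: "closed {t. F t \<le> h}"
      using cont_F[of UNIV] by (intro closed_Collect_le continuous_on_const) auto
    obtain a where "a \<le> p" "F a \<le> h"
    proof -
      have "\<forall>\<^sub>F t in at_bot. F t < h \<and> t \<le> p"
        by (intro eventually_conj order_tendstoD(2)[OF bot] h eventually_le_at_bot)
      then show thesis using that by (metis (mono_tags, lifting) eventually_happens less_imp_le trivial_limit_at_bot_linorder)
    qed
    obtain b where "p \<le> b" "F b \<le> h"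
    proof -
      have "\<forall>\<^sub>F t in at_top. F t < h \<and> p \<le> t"
        by (intro eventually_conj order_tendstoD(2)[OF top] h eventually_ge_at_top)
      then show thesis using that by (metis (mono_tags, lifting) eventually_happens less_imp_le trivial_limit_at_top_linorder)
    qed
    \<comment> \<open>The ends of the excursion above \<open>h\<close> around \<open>p\<close>; \<open>a\<close> and \<open>b\<close> only make the sets bounded.\<close>
    define x where "x = Sup ({t. F t \<le> h} \<inter> {a..p})"
    define y where "y = Inf ({t. F t \<le> h} \<inter> {p..b})"
    have X: "x \<in> {t. F t \<le> h} \<inter> {a..p}"
      unfolding x_def using \<open>a \<le> p\<close> \<open>F a \<le> h\<close>
      by (intro closed_contains_Sup closed_Int closed closed_atLeastAtMost) auto
    have Y: "y \<in> {t. F t \<le> h} \<inter> {p..b}"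
      unfolding y_def using \<open>p \<le> b\<close> \<open>F b \<le> h\<close>
      by (intro closed_contains_Inf closed_Int closed closed_atLeastAtMost) auto
    have x_less: "h < F t" if "x < t" "t \<le> p" for t
    proof (rule ccontr)
      assume "\<not> h < F t"
      then have "t \<le> x" unfolding x_def using that X by (intro cSup_upper) auto
      with that show False by simp
    qed
    have y_less: "h < F t" if "p \<le> t" "t < y" for t
    proof (rule ccontr)
      assume "\<not> h < F t"
      then have "y \<le> t" unfolding y_def using that Y by (intro cInf_lower) auto
      with that show False by simp
    qed
    have "F x = h"
    proof (rule ccontr)
      assume "F x \<noteq> h"
      then have "F x < h" using X by simp
      then obtain t where "x \<le> t" "t \<le> p" "F t = h"
        using IVT'[of F x h p] h X cont_F by auto
      with x_less[of t] \<open>F x \<noteq> h\<close> show False by (cases "x = t") auto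
    qed
    have "F y = h"
    proof (rule ccontr)
      assume "F y \<noteq> h"
      then have "F y < h" using Y by simp
      then obtain t where "p \<le> t" "t \<le> y" "F t = h"
        using IVT2'[of F y h p] h Y cont_F by auto
      with y_less[of t] \<open>F y \<noteq> h\<close> show False by (cases "y = t") auto
    qed
    have ge: "h \<le> F t" if "x \<le> t" "t \<le> y" for t
      using that x_less[of t] y_less[of t] \<open>F x = h\<close> \<open>F y = h\<close>
      by (cases "t = x"; cases "t = y"; cases "t \<le> p") auto
    have "H x y \<le> cdf \<mu> x - h"
    proof (rule transport_cdf_least)
      fix z assume "z \<le> y"
      show "cdf \<nu> z - max 0 (cdf \<mu> z - cdf \<mu> x) \<le> cdf \<mu> x - h"
      proof (cases "x \<le> z")
        case True
        then show ?thesis using ge[OF True \<open>z \<le> y\<close>] \<mu>.cdf_nondecreasing[OF True] by (simp add: F_def)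
      next
        case False
        then show ?thesis using \<nu>.cdf_nondecreasing[of z x] \<open>F x = h\<close> by (simp add: F_def)
      qed
    qed
    then have "cdf \<nu> y \<le> cdf \<mu> x - h"
      using eq h by (simp add: H_vee_def)
    moreover have "x \<le> p" "p \<le> y" using X Y by auto
    ultimately have "F p \<le> h"
      using \<open>F x = h\<close> \<open>F y = h\<close> \<mu>.cdf_nondecreasing[of p y] \<nu>.cdf_nondecreasing[of x p]
      by (simp add: F_def)
    with h show False by simp
  qed
  then have "cdf \<mu> = cdf \<nu>"
    using cdf_le by (auto simp: F_def fun_eq_iff intro: antisym)
  then show "\<mu> = \<nu>" by (rule cdf_unique[OF real_distributions])
qed

end

section \<open>Unimodality as quasi-concavity\<close>

text \<open>
  For the converse the mode is \<open>x0 = Sup R\<close>, where \<open>R\<close> is the set of points that are exceeded somewhere to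
  their right. Before a point of \<open>R\<close> quasi-concavity makes \<open>F\<close> nondecreasing, and after \<open>x0\<close> no
  point is exceeded later, so \<open>F\<close> is nonincreasing there, by right continuity from \<open>x0\<close> on. The limit at
  \<open>\<infinity>\<close> bounds \<open>R\<close>: far to the right, \<open>F\<close> cannot rise again once it has fallen below an earlier positive
  value. If \<open>R\<close> is empty, \<open>F\<close> is nonincreasing and vanishes at \<open>-\<infinity>\<close>, so it is zero.
\<close>

lemma unimodal_iff_quasiconcave:
  fixes F :: "real \<Rightarrow> real"
  assumes right: "\<And>a. continuous (at_right a) F"
    and bot: "(F \<longlongrightarrow> 0) at_bot" and top: "(F \<longlongrightarrow> 0) at_top" and nonneg: "\<And>t. 0 \<le> F t"
  shows "unimodal F \<longleftrightarrow> (\<forall>x z y. x \<le> z \<longrightarrow> z \<le> y \<longrightarrow> min (F x) (F y) \<le> F z)"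
proof
  assume "unimodal F"
  then obtain x0 where inc: "mono_on {..<x0} F" and dec: "antimono_on {x0..} F"
    by (auto simp: unimodal_def)
  show "\<forall>x z y. x \<le> z \<longrightarrow> z \<le> y \<longrightarrow> min (F x) (F y) \<le> F z"
  proof (intro allI impI)
    fix x z y :: real assume "x \<le> z" "z \<le> y"
    show "min (F x) (F y) \<le> F z"
    proof (cases "z < x0")
      case True
      then have "F x \<le> F z" using inc \<open>x \<le> z\<close> by (auto simp: monotone_on_def)
      then show ?thesis by simp
    next
      case False
      then have "F y \<le> F z" using dec \<open>z \<le> y\<close> by (auto simp: monotone_on_def)
      then show ?thesis by simp
    qed
  qed
next
  assume "\<forall>x z y. x \<le> z \<longrightarrow> z \<le> y \<longrightarrow> min (F x) (F y) \<le> F z"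
  then have qc: "min (F x) (F y) \<le> F z" if "x \<le> z" "z \<le> y" for x y z
    using that by blast
  define R where "R = {t. \<exists>s>t. F t < F s}"
  show "unimodal F"
  proof (cases "R = {}")
    case True
    then have anti: "F s \<le> F t" if "t \<le> s" for s t
    proof (cases "t = s")
      case False
      with that have "t < s" by simp
      moreover have "t \<notin> R" using True by simp
      ultimately have "\<not> F t < F s" by (auto simp: R_def)
      then show ?thesis by simp
    qed simp
    have "F s \<le> 0" for s
      by (rule tendsto_lowerbound[OF bot])
        (auto simp: eventually_at_bot_linorder anti intro!: exI[of _ s])
    then have "F s = 0" for s using nonneg[of s] by (rule antisym)
    then show ?thesis by (auto simp: unimodal_def monotone_on_def)
  next
    case False
    then obtain t0 s0 where ts: "t0 < s0" "F t0 < F s0" by (auto simp: R_def)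
    then have "0 < F s0" using nonneg[of t0] by simp
    then obtain b where b: "\<And>t. b \<le> t \<Longrightarrow> F t < F s0"
      using order_tendstoD(2)[OF top] by (auto simp: eventually_at_top_linorder)
    have "t \<le> max b s0" if t: "t \<in> R" for t
    proof (rule ccontr)
      assume "\<not> t \<le> max b s0"
      then have "b \<le> t" "s0 \<le> t" by auto
      moreover obtain s where "t < s" "F t < F s" using t by (auto simp: R_def)
      ultimately show False using qc[of s0 t s] b[of t] by simp
    qed
    then have bdd: "bdd_above R" by (rule bdd_aboveI)
    define x0 where "x0 = Sup R"
    have "F u \<le> F t" if ut: "u \<le> t" "t < x0" for u t
    proof -
      obtain t' where "t' \<in> R" "t < t'"
        using ut(2) less_cSup_iff[OF False bdd] by (auto simp: x0_def)
      then obtain s where "t' < s" "F t' < F s" by (auto simp: R_def)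
      show ?thesis
        using qc[of u t t'] qc[of u t s] qc[of t t' s] qc[of u t' s] ut \<open>t < t'\<close> \<open>t' < s\<close> \<open>F t' < F s\<close>
        by (simp add: min_def split: if_splits)
    qed
    then have "mono_on {..<x0} F" by (auto simp: monotone_on_def)
    moreover have after: "F s \<le> F t" if "x0 < t" "t \<le> s" for s t
    proof (rule ccontr)
      assume "\<not> F s \<le> F t"
      with that have "t < s" by (cases "t = s") auto
      with \<open>\<not> F s \<le> F t\<close> have "t \<in> R" by (auto simp: R_def intro!: exI[of _ s])
      then have "t \<le> x0" unfolding x0_def by (rule cSup_upper) (rule bdd)
      with that show False by simp
    qed
    have "F s \<le> F x0" if "x0 \<le> s" for s
    proof (cases "s = x0")
      case False
      show ?thesis
      proof (rule tendsto_lowerbound)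
        show "(F \<longlongrightarrow> F x0) (at_right x0)"
          using right[of x0] by (simp add: continuous_within)
        show "\<forall>\<^sub>F t in at_right x0. F s \<le> F t"
          unfolding eventually_at_right_field using that False by (auto intro!: exI[of _ s] after)
      qed simp
    qed simp
    then have "antimono_on {x0..} F"
      using after by (auto simp: monotone_on_def) (metis order_le_imp_less_or_eq)
    ultimately show ?thesis by (auto simp: unimodal_def)
  qed
qed

theorem corollary4p3:
  fixes \<mu> \<nu> :: "real measure"
  assumes "real_distribution \<mu>" and "real_distribution \<nu>" and "\<mu> \<preceq>\<^sub>s\<^sub>t \<nu>"
  shows "(\<forall>x y. H_wedge \<mu> \<nu> x y \<le> optimal_cdf \<mu> \<nu> x y \<and> optimal_cdf \<mu> \<nu> x y \<le> H_vee \<mu> \<nu> x y)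
    \<and> (optimal_cdf \<mu> \<nu> = H_wedge \<mu> \<nu> \<longleftrightarrow> unimodal (\<lambda>t. cdf \<mu> t - cdf \<nu> t))
    \<and> (optimal_cdf \<mu> \<nu> = H_vee \<mu> \<nu> \<longleftrightarrow> is_singleton (directional_couplings \<mu> \<nu>))
    \<and> (continuous_on UNIV (\<lambda>t. cdf \<mu> t - cdf \<nu> t) \<longrightarrow>
         (optimal_cdf \<mu> \<nu> = H_vee \<mu> \<nu> \<longleftrightarrow> \<mu> = \<nu>) \<and>
         (is_singleton (directional_couplings \<mu> \<nu>) \<longleftrightarrow> \<mu> = \<nu>))"
proof -
  interpret \<mu>: real_distribution \<mu> by fact
  interpret \<nu>: real_distribution \<nu> by fact
  interpret st_ordered \<mu> \<nu>
    by unfold_locales (use assms(3) in \<open>simp add: st_le_def\<close>)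
  have "unimodal (\<lambda>t. cdf \<mu> t - cdf \<nu> t) \<longleftrightarrow> H = H_wedge \<mu> \<nu>"
    unfolding H_eq_H_wedge_iff
  proof (rule unimodal_iff_quasiconcave)
    show "continuous (at_right a) (\<lambda>t. cdf \<mu> t - cdf \<nu> t)" for a
      by (intro continuous_intros \<mu>.cdf_is_right_cont \<nu>.cdf_is_right_cont)
    show "((\<lambda>t. cdf \<mu> t - cdf \<nu> t) \<longlongrightarrow> 0) at_bot"
      using tendsto_diff[OF \<mu>.cdf_lim_at_bot \<nu>.cdf_lim_at_bot] by simp
    show "((\<lambda>t. cdf \<mu> t - cdf \<nu> t) \<longlongrightarrow> 0) at_top"
      using tendsto_diff[OF \<mu>.cdf_lim_at_top_prob \<nu>.cdf_lim_at_top_prob] by simp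
  qed (simp add: cdf_le)
  moreover have "H x y \<le> H_vee \<mu> \<nu> x y" for x y
    by (simp add: H_vee_def H_le_first H_le_second)
  ultimately show ?thesis
    using H_wedge_le_H H_eq_H_vee_iff_singleton H_eq_H_vee_iff_eq by (simp add: optimal_cdf_eq)
qed

end
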